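(* Let $\theta\in(0,1)$ be an irrational number and let $A_\theta$ be the universal $C^*$-algebra generated by unitaries $u,v$ with $vu=e^{2\pi i\theta}uv$. Then for $\lambda>0$ the spectrum of $u+\lambda v$ is $$\sigma(u+\lambda v)=\begin{cases}\mathbb{T}, & 0<\lambda<1,\\ \overline{B(0,1)}, & \lambda=1,\\ \lambda\mathbb{T}, & \lambda>1.\end{cases}$$
   Context: $\mathbb{T}$ is the unit circle in $\mathbb{C}$, $\lambda\mathbb{T}$ the circle of radius $\lambda$ centered at $0$, and $\overline{B(0,1)}$ the closed unit disk. *)

theory Defs
  imports "HOL-Algebra.Module" "HOL-Analysis.Analysis"
begin

text \<open>
  Nonzero unital C*-algebras as a type class. Completeness comes from \<^class>\<open>banach\<close>;
  the complex scalar multiplication extends the real one inherited from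
  \<^class>\<open>real_normed_algebra_1\<close>.
\<close>

class cstar_algebra = real_normed_algebra_1 + banach +
  fixes scaleC :: "complex \<Rightarrow> 'a \<Rightarrow> 'a"  (infixr "*\<^sub>C" 75)
    and adj :: "'a \<Rightarrow> 'a"
  assumes scaleC_add_right: "a *\<^sub>C (x + y) = a *\<^sub>C x + a *\<^sub>C y"
    and scaleC_add_left: "(a + b) *\<^sub>C x = a *\<^sub>C x + b *\<^sub>C x"
    and scaleC_scaleC: "a *\<^sub>C (b *\<^sub>C x) = (a * b) *\<^sub>C x"
    and scaleC_of_real: "complex_of_real r *\<^sub>C x = r *\<^sub>R x"
    and scaleC_mult_left: "(a *\<^sub>C x) * y = a *\<^sub>C (x * y)"
    and scaleC_mult_right: "x * (a *\<^sub>C y) = a *\<^sub>C (x * y)"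
    and norm_scaleC: "norm (a *\<^sub>C x) = cmod a * norm x"
    and adj_add: "adj (x + y) = adj x + adj y"
    and adj_scaleC: "adj (a *\<^sub>C x) = cnj a *\<^sub>C adj x"
    and adj_mult: "adj (x * y) = adj y * adj x"
    and adj_adj: "adj (adj x) = x"
    and cstar_identity: "norm (adj x * x) = norm x ^ 2"

definition is_unitary :: "'a::cstar_algebra \<Rightarrow> bool" where
  "is_unitary x \<longleftrightarrow> adj x * x = 1 \<and> x * adj x = 1"

definition cstar_spectrum :: "'a::cstar_algebra \<Rightarrow> complex set" where
  "cstar_spectrum x =
     {\<mu>. \<not> (\<exists>y. y * (x - \<mu> *\<^sub>C 1) = 1 \<and> (x - \<mu> *\<^sub>C 1) * y = 1)}"

definition cstar_subalgebra :: "'a::cstar_algebra set \<Rightarrow> bool" where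
  "cstar_subalgebra S \<longleftrightarrow> closed S \<and> 1 \<in> S \<and>
     (\<forall>x\<in>S. \<forall>y\<in>S. x + y \<in> S \<and> x * y \<in> S) \<and>
     (\<forall>x\<in>S. adj x \<in> S \<and> (\<forall>a. a *\<^sub>C x \<in> S))"

text \<open>
  Unital C*-algebras whose carrier is a subset of a type. They are needed because a universal
  property quantifies over C*-algebras inside a formula, which is impossible for types.
\<close>

definition complex_ring :: "complex ring" where
  "complex_ring = \<lparr>carrier = UNIV, monoid.mult = (*), one = 1, zero = 0, add = (+)\<rparr>"

record 'b cstar_structure = "(complex, 'b) module" +
  cadj :: "'b \<Rightarrow> 'b"
  cnorm :: "'b \<Rightarrow> real"

locale cstar_on = Module.module complex_ring B + Ring.ring B
  for B :: "'b cstar_structure" (structure) +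
  assumes smult_mult_left: "\<lbrakk>x \<in> carrier B; y \<in> carrier B\<rbrakk> \<Longrightarrow>
      (a \<odot> x) \<otimes> y = a \<odot> (x \<otimes> y)"
    and smult_mult_right: "\<lbrakk>x \<in> carrier B; y \<in> carrier B\<rbrakk> \<Longrightarrow>
      x \<otimes> (a \<odot> y) = a \<odot> (x \<otimes> y)"
    and cnorm_nonneg: "x \<in> carrier B \<Longrightarrow> 0 \<le> cnorm B x"
    and cnorm_eq_0: "x \<in> carrier B \<Longrightarrow> cnorm B x = 0 \<longleftrightarrow> x = \<zero>"
    and cnorm_triangle: "\<lbrakk>x \<in> carrier B; y \<in> carrier B\<rbrakk> \<Longrightarrow>
      cnorm B (x \<oplus> y) \<le> cnorm B x + cnorm B y"
    and cnorm_smult: "x \<in> carrier B \<Longrightarrow> cnorm B (a \<odot> x) = cmod a * cnorm B x"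
    and cnorm_mult: "\<lbrakk>x \<in> carrier B; y \<in> carrier B\<rbrakk> \<Longrightarrow>
      cnorm B (x \<otimes> y) \<le> cnorm B x * cnorm B y"
    and complete: "\<lbrakk>range X \<subseteq> carrier B;
      \<forall>e>0. \<exists>N. \<forall>m\<ge>N. \<forall>n\<ge>N. cnorm B (X m \<ominus> X n) < e\<rbrakk> \<Longrightarrow>
      \<exists>x\<in>carrier B. (\<lambda>n. cnorm B (X n \<ominus> x)) \<longlonglongrightarrow> 0"
    and cadj_closed: "x \<in> carrier B \<Longrightarrow> cadj B x \<in> carrier B"
    and cadj_add: "\<lbrakk>x \<in> carrier B; y \<in> carrier B\<rbrakk> \<Longrightarrow>
      cadj B (x \<oplus> y) = cadj B x \<oplus> cadj B y"
    and cadj_smult: "x \<in> carrier B \<Longrightarrow> cadj B (a \<odot> x) = cnj a \<odot> cadj B x"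
    and cadj_mult: "\<lbrakk>x \<in> carrier B; y \<in> carrier B\<rbrakk> \<Longrightarrow>
      cadj B (x \<otimes> y) = cadj B y \<otimes> cadj B x"
    and cadj_cadj: "x \<in> carrier B \<Longrightarrow> cadj B (cadj B x) = x"
    and cnorm_cadj_mult: "x \<in> carrier B \<Longrightarrow> cnorm B (cadj B x \<otimes> x) = cnorm B x ^ 2"

definition is_unitary_on :: "'b cstar_structure \<Rightarrow> 'b \<Rightarrow> bool" where
  "is_unitary_on B x \<longleftrightarrow> x \<in> carrier B \<and>
     cadj B x \<otimes>\<^bsub>B\<^esub> x = \<one>\<^bsub>B\<^esub> \<and> x \<otimes>\<^bsub>B\<^esub> cadj B x = \<one>\<^bsub>B\<^esub>"

definition star_hom_to :: "'b cstar_structure \<Rightarrow> ('a::cstar_algebra \<Rightarrow> 'b) \<Rightarrow> bool" where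
  "star_hom_to B \<pi> \<longleftrightarrow> range \<pi> \<subseteq> carrier B \<and> \<pi> 1 = \<one>\<^bsub>B\<^esub> \<and>
     (\<forall>x y. \<pi> (x + y) = \<pi> x \<oplus>\<^bsub>B\<^esub> \<pi> y) \<and>
     (\<forall>x y. \<pi> (x * y) = \<pi> x \<otimes>\<^bsub>B\<^esub> \<pi> y) \<and>
     (\<forall>a x. \<pi> (a *\<^sub>C x) = a \<odot>\<^bsub>B\<^esub> \<pi> x) \<and>
     (\<forall>x. \<pi> (adj x) = cadj B (\<pi> x))"

text \<open>
  \<open>universal_rotation_algebra \<theta> u v\<close>: the type \<open>'a\<close> is the universal C*-algebra generated by
  unitaries \<open>u\<close>, \<open>v\<close> with \<open>v u = e\<^sup>2\<^sup>\<pi>\<^sup>i\<^sup>\<theta> u v\<close>. The algebras \<open>B\<close> range over those carried by a subset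
  of \<open>'a\<close>. This loses nothing: a pair \<open>U\<close>, \<open>V\<close> in an arbitrary C*-algebra generates a separable
  C*-subalgebra, which has at most as many elements as the continuum, whereas \<open>'a\<close> has at least
  that many because it contains a copy of the complex numbers. The homomorphism is unique because
  \<open>u\<close> and \<open>v\<close> generate and *-homomorphisms are continuous.
\<close>

definition universal_rotation_algebra :: "real \<Rightarrow> 'a::cstar_algebra \<Rightarrow> 'a \<Rightarrow> bool" where
  "universal_rotation_algebra \<theta> u v \<longleftrightarrow>
     is_unitary u \<and> is_unitary v \<and>
     v * u = exp (2 * complex_of_real pi * \<i> * complex_of_real \<theta>) *\<^sub>C (u * v) \<and>
     cstar_subalgebra hull {u, v} = UNIV \<and>
     (\<forall>(B :: 'a cstar_structure) U V.
        cstar_on B \<and> is_unitary_on B U \<and> is_unitary_on B V \<and>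
        V \<otimes>\<^bsub>B\<^esub> U =
          exp (2 * complex_of_real pi * \<i> * complex_of_real \<theta>) \<odot>\<^bsub>B\<^esub> (U \<otimes>\<^bsub>B\<^esub> V) \<longrightarrow>
        (\<exists>\<pi> :: 'a \<Rightarrow> 'a. star_hom_to B \<pi> \<and> \<pi> u = U \<and> \<pi> v = V))"

text \<open>The two renderings agree: the algebra of a type is one of the algebras on that type.\<close>

definition cstar_structure_of_type :: "'a::cstar_algebra cstar_structure" where
  "cstar_structure_of_type =
     \<lparr>carrier = UNIV, monoid.mult = (*), one = 1, zero = 0, add = (+), module.smult = (*\<^sub>C),
      cadj = adj, cnorm = norm\<rparr>"

lemma cring_complex_ring: "cring complex_ring"
proof (rule cringI)
  show "abelian_group complex_ring"
    by (rule abelian_groupI)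
      (auto simp: complex_ring_def add.assoc add.commute intro: exI[of _ "- x" for x] left_minus)
  show "comm_monoid complex_ring"
    by (rule comm_monoidI) (auto simp: complex_ring_def)
qed (auto simp: complex_ring_def algebra_simps)

lemma ring_cstar_structure_of_type:
  "Ring.ring (cstar_structure_of_type :: 'a::cstar_algebra cstar_structure)"
proof (rule ringI)
  show "abelian_group (cstar_structure_of_type :: 'a cstar_structure)"
    by (rule abelian_groupI)
      (auto simp: cstar_structure_of_type_def add.assoc add.commute
        intro: exI[of _ "- x" for x] left_minus)
  show "monoid (cstar_structure_of_type :: 'a cstar_structure)"
    by (rule monoidI) (auto simp: cstar_structure_of_type_def mult.assoc)
qed (auto simp: cstar_structure_of_type_def algebra_simps)

lemma cstar_on_cstar_structure_of_type:
  "cstar_on (cstar_structure_of_type :: 'a::cstar_algebra cstar_structure)"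
proof -
  let ?B = "cstar_structure_of_type :: 'a cstar_structure"
  interpret B: Ring.ring ?B by (rule ring_cstar_structure_of_type)
  have one: "1 *\<^sub>C x = x" for x :: 'a
    using scaleC_of_real[of 1 x] by simp
  have minus: "x \<ominus>\<^bsub>?B\<^esub> y = x - y" for x y :: 'a
  proof -
    have "y \<oplus>\<^bsub>?B\<^esub> (\<ominus>\<^bsub>?B\<^esub> y) = \<zero>\<^bsub>?B\<^esub>"
      by (rule B.r_neg) (simp add: cstar_structure_of_type_def)
    then have "\<ominus>\<^bsub>?B\<^esub> y = - y"
      by (simp add: cstar_structure_of_type_def add_eq_0_iff)
    then show ?thesis
      by (simp add: a_minus_def) (simp add: cstar_structure_of_type_def)
  qed
  have mod: "Module.module complex_ring ?B"
    by (intro Module.module.intro Module.module_axioms.intro cring_complex_ring B.abelian_group_axioms)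
      (auto simp: complex_ring_def cstar_structure_of_type_def one
        scaleC_add_left scaleC_add_right scaleC_scaleC)
  have compl: "\<exists>x\<in>carrier ?B. (\<lambda>n. cnorm ?B (X n \<ominus>\<^bsub>?B\<^esub> x)) \<longlonglongrightarrow> 0"
    if "\<forall>e>0. \<exists>N. \<forall>m\<ge>N. \<forall>n\<ge>N. cnorm ?B (X m \<ominus>\<^bsub>?B\<^esub> X n) < e" for X
  proof -
    have "Cauchy X"
      using that by (simp add: minus Cauchy_def dist_norm) (simp add: cstar_structure_of_type_def)
    then obtain x where "X \<longlonglongrightarrow> x"
      using Cauchy_convergent convergent_def by blast
    then have "(\<lambda>n. norm (X n - x)) \<longlonglongrightarrow> 0"
      by (simp add: LIM_zero tendsto_norm_zero)
    then show ?thesis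
      by (intro bexI[of _ x]) (simp_all add: minus, simp_all add: cstar_structure_of_type_def)
  qed
  show ?thesis
  proof (intro cstar_on.intro cstar_on_axioms.intro mod ring_cstar_structure_of_type compl)
  qed (auto simp: cstar_structure_of_type_def scaleC_mult_left scaleC_mult_right norm_triangle_ineq
      norm_scaleC norm_mult_ineq adj_add adj_scaleC adj_mult adj_adj cstar_identity)
qed

end

theory Submission
  imports Defs
begin

text \<open>
  Write \<open>q = e\<^sup>2\<^sup>\<pi>\<^sup>i\<^sup>\<theta>\<close>. The \<open>q\<close>-binomial theorem expands \<open>(x + y)\<^sup>n\<close> whenever \<open>y x = q x y\<close>, and its
  coefficients grow subexponentially because \<open>\<Prod>k<n. 1 + q\<^sup>k z\<close> does so on every circle of radius less
  than \<open>1\<close>. Hence \<open>c + a u + b v\<close> is invertible if \<open>\<bar>a\<bar>\<close> and \<open>\<bar>b\<bar>\<close> are less than \<open>\<bar>c\<bar>\<close>. Up to a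
  unitary factor the three terms may be permuted, since \<open>u\<^sup>* v\<close> and \<open>u\<^sup>*\<close> satisfy the same relation
  as \<open>u\<close> and \<open>v\<close>, so it suffices that any one coefficient dominates the other two; this confines the
  spectrum to the asserted set. For \<open>\<lambda> < 1\<close> the spectrum is nonempty, closed and invariant under
  multiplication by \<open>q\<close>, because \<open>u\<^sup>* v\<close> conjugates \<open>u + \<lambda> v\<close> to a multiple of itself, so it is the
  whole circle. The case \<open>\<lambda> > 1\<close> follows by exchanging \<open>u\<close> and \<open>v\<close>. For \<open>\<lambda> = 1\<close> and \<open>\<bar>\<mu>\<bar> < 1\<close> one has
  \<open>u + v - \<mu> = u (1 + (u\<^sup>* v - \<mu> u\<^sup>*))\<close>, and \<open>-1\<close> is a spectral value of \<open>u\<^sup>* v - \<mu> u\<^sup>*\<close> by the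
  first case.
\<close>

section \<open>Invertible elements and the spectrum\<close>

lemma scaleC_one [simp]: "1 *\<^sub>C x = (x :: 'a::cstar_algebra)"
  using scaleC_of_real[of 1 x] by simp

lemma scaleC_zero_left [simp]: "0 *\<^sub>C x = (0 :: 'a::cstar_algebra)"
  using scaleC_of_real[of 0 x] by simp

lemma scaleC_minus_left: "(- a) *\<^sub>C x = - (a *\<^sub>C (x :: 'a::cstar_algebra))"
  using scaleC_add_left[of "-a" a x] by (simp add: eq_neg_iff_add_eq_0)

lemma bounded_bilinear_scaleC: "bounded_bilinear (scaleC :: complex \<Rightarrow> 'a::cstar_algebra \<Rightarrow> 'a)"
proof
  fix a b :: complex and r :: real and x y :: 'a
  show "(r *\<^sub>R a) *\<^sub>C x = r *\<^sub>R (a *\<^sub>C x)"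
    by (simp add: scaleC_scaleC scaleR_conv_of_real[of r a] flip: scaleC_of_real)
  show "a *\<^sub>C (r *\<^sub>R x) = r *\<^sub>R (a *\<^sub>C x)"
    by (simp add: scaleC_scaleC mult.commute flip: scaleC_of_real)
  show "\<exists>K. \<forall>a (x::'a). norm (a *\<^sub>C x) \<le> norm a * norm x * K"
    by (rule exI[of _ 1]) (simp add: norm_scaleC)
qed (rule scaleC_add_left scaleC_add_right)+

interpretation scaleC: bounded_bilinear "scaleC :: complex \<Rightarrow> 'a::cstar_algebra \<Rightarrow> 'a"
  by (rule bounded_bilinear_scaleC)

lemma has_vector_derivative_iff_slope:
  "(f has_vector_derivative D) (at t) \<longleftrightarrow> ((\<lambda>s. (f s - f t) /\<^sub>R (s - t)) \<longlongrightarrow> D) (at t)"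
proof -
  have "(f has_vector_derivative D) (at t) \<longleftrightarrow>
      ((\<lambda>s. norm (f s - f t - (s - t) *\<^sub>R D) / norm (s - t)) \<longlongrightarrow> 0) (at t)"
    by (simp add: has_vector_derivative_def has_derivative_iff_norm bounded_linear_scaleR_left)
  also have "\<dots> \<longleftrightarrow> ((\<lambda>s. norm ((f s - f t) /\<^sub>R (s - t) - D)) \<longlongrightarrow> 0) (at t)"
  proof (rule tendsto_cong)
    have "norm (f s - f t - (s - t) *\<^sub>R D) / norm (s - t) = norm ((f s - f t) /\<^sub>R (s - t) - D)"
      if "s \<noteq> t" for s
    proof -
      have "(f s - f t) /\<^sub>R (s - t) - D = (f s - f t - (s - t) *\<^sub>R D) /\<^sub>R (s - t)"
        using that by (simp add: scaleR_diff_right)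
      then show ?thesis by (simp add: divide_inverse_commute)
    qed
    then show "\<forall>\<^sub>F s in at t. norm (f s - f t - (s - t) *\<^sub>R D) / norm (s - t)
        = norm ((f s - f t) /\<^sub>R (s - t) - D)"
      by (auto simp: eventually_at_filter)
  qed
  finally show ?thesis
    by (simp add: tendsto_norm_zero_iff LIM_zero_iff)
qed

definition is_invertible :: "'a::monoid_mult \<Rightarrow> bool" where
  "is_invertible x \<longleftrightarrow> (\<exists>y. y * x = 1 \<and> x * y = 1)"

lemma is_invertible_mult:
  assumes "is_invertible x" "is_invertible y"
  shows "is_invertible (x * y)"
proof -
  obtain x' y' where *: "x' * x = 1" "x * x' = 1" "y' * y = 1" "y * y' = 1"
    using assms by (auto simp: is_invertible_def)
  have "(y' * x') * (x * y) = y' * (x' * x) * y" "(x * y) * (y' * x') = x * (y * y') * x'"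
    by (simp_all only: mult.assoc)
  then show ?thesis
    using * by (auto simp: is_invertible_def)
qed

lemma is_invertible_mult_left_iff:
  assumes "is_invertible x"
  shows "is_invertible (x * y) \<longleftrightarrow> is_invertible y"
proof
  obtain x' where *: "x' * x = 1" "x * x' = 1"
    using assms by (auto simp: is_invertible_def)
  then have "is_invertible x'" by (auto simp: is_invertible_def)
  moreover have "x' * (x * y) = y" using * by (simp flip: mult.assoc)
  ultimately show "is_invertible y" if "is_invertible (x * y)"
    using is_invertible_mult[of x' "x * y"] that by simp
qed (use assms is_invertible_mult in blast)

lemma is_invertible_scaleC_iff:
  assumes "a \<noteq> 0"
  shows "is_invertible (a *\<^sub>C x) \<longleftrightarrow> is_invertible (x :: 'a::cstar_algebra)"
proof -
  have "is_invertible (a *\<^sub>C (1 :: 'a))"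
    unfolding is_invertible_def using assms
    by (intro exI[of _ "inverse a *\<^sub>C 1"]) (simp add: scaleC_mult_left scaleC_scaleC)
  then show ?thesis
    using is_invertible_mult_left_iff[of "a *\<^sub>C 1" x] by (simp add: scaleC_mult_left)
qed

lemma is_invertible_one_minus:
  fixes x :: "'a::{real_normed_algebra_1, banach}"
  assumes "summable (\<lambda>n. norm (x ^ n))"
  shows "is_invertible (1 - x)"
proof -
  have s: "summable (\<lambda>n. x ^ n)"
    using assms by (rule summable_norm_cancel)
  have "(\<Sum>n. x ^ Suc n) = (\<Sum>n. x ^ n) - 1"
    using suminf_split_head[OF s] by simp
  then have "x * (\<Sum>n. x ^ n) = (\<Sum>n. x ^ n) - 1" "(\<Sum>n. x ^ n) * x = (\<Sum>n. x ^ n) - 1"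
    using suminf_mult[OF s, of x] suminf_mult2[OF s, of x] by (simp_all add: power_commutes)
  then show ?thesis
    unfolding is_invertible_def by (intro exI[of _ "\<Sum>n. x ^ n"]) (simp add: algebra_simps)
qed

lemma is_invertible_one_minus_small:
  fixes x :: "'a::{real_normed_algebra_1, banach}"
  assumes "norm x < 1"
  shows "is_invertible (1 - x)"
  by (rule is_invertible_one_minus, rule summable_comparison_test'[of "\<lambda>n. norm x ^ n" 0])
    (use assms in \<open>simp_all add: summable_geometric norm_power_ineq\<close>)

lemma mem_cstar_spectrum_iff: "\<mu> \<in> cstar_spectrum x \<longleftrightarrow> \<not> is_invertible (x - \<mu> *\<^sub>C 1)"
  by (simp add: cstar_spectrum_def is_invertible_def)

lemma closed_cstar_spectrum: "closed (cstar_spectrum (x :: 'a::cstar_algebra))"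
proof -
  have "\<exists>e>0. \<forall>\<nu>. dist \<nu> \<mu> < e \<longrightarrow> \<nu> \<in> - cstar_spectrum x" if mu: "\<mu> \<in> - cstar_spectrum x" for \<mu>
  proof -
    obtain y where y: "y * (x - \<mu> *\<^sub>C 1) = 1" "(x - \<mu> *\<^sub>C 1) * y = 1"
      using mu unfolding cstar_spectrum_def by blast
    have "\<nu> \<in> - cstar_spectrum x" if "dist \<nu> \<mu> < 1 / (norm y + 1)" for \<nu>
    proof -
      have "cmod (\<nu> - \<mu>) * (norm y + 1) < 1"
        using that by (simp add: dist_norm field_simps add_pos_nonneg)
      moreover have "cmod (\<nu> - \<mu>) * norm y \<le> cmod (\<nu> - \<mu>) * (norm y + 1)"
        by (intro mult_left_mono) auto
      ultimately have "norm ((\<nu> - \<mu>) *\<^sub>C y) < 1"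
        by (simp add: norm_scaleC)
      then have "is_invertible ((x - \<mu> *\<^sub>C 1) * (1 - (\<nu> - \<mu>) *\<^sub>C y))"
        using y by (intro is_invertible_mult is_invertible_one_minus_small)
          (auto simp: is_invertible_def)
      also have "(x - \<mu> *\<^sub>C 1) * (1 - (\<nu> - \<mu>) *\<^sub>C y) = x - \<nu> *\<^sub>C 1"
        using y by (simp add: right_diff_distrib scaleC_mult_right scaleC.diff_left)
      finally show ?thesis by (simp add: mem_cstar_spectrum_iff)
    qed
    then show ?thesis
      by (intro exI[of _ "1 / (norm y + 1)"]) (auto simp: add_nonneg_pos)
  qed
  then show ?thesis
    by (simp add: closed_def open_dist)
qed

context
  fixes x :: "'a::cstar_algebra" and R :: "complex \<Rightarrow> 'a"
  assumes R_left: "\<And>z. R z * (1 - z *\<^sub>C x) = 1" and R_right: "\<And>z. (1 - z *\<^sub>C x) * R z = 1"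
begin

lemma resolvent_identity: "R z - R w = (z - w) *\<^sub>C (R z * x * R w)"
proof -
  have "R z * ((1 - w *\<^sub>C x) - (1 - z *\<^sub>C x)) * R w
      = R z * ((1 - w *\<^sub>C x) * R w) - (R z * (1 - z *\<^sub>C x)) * R w"
    by (simp only: left_diff_distrib right_diff_distrib mult.assoc)
  then have "R z - R w = R z * ((1 - w *\<^sub>C x) - (1 - z *\<^sub>C x)) * R w"
    by (simp add: R_left R_right)
  also have "(1 - w *\<^sub>C x) - (1 - z *\<^sub>C x) = (z - w) *\<^sub>C x"
    by (simp add: scaleC.diff_left)
  finally show ?thesis by (simp add: scaleC_mult_left scaleC_mult_right)
qed

lemma isCont_resolvent: "isCont R w"
proof -
  define K where "K = norm x * norm (R w)"
  have K: "K \<ge> 0" by (simp add: K_def)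
  have le: "norm (R z - R w) \<le> cmod (z - w) * K * norm (R z)" for z
  proof -
    have "norm (R z * x * R w) \<le> norm (R z) * norm x * norm (R w)"
      by (meson mult_right_mono norm_ge_zero norm_mult_ineq order_trans)
    then have "cmod (z - w) * norm (R z * x * R w) \<le> cmod (z - w) * (norm (R z) * norm x * norm (R w))"
      by (rule mult_left_mono) simp
    then show ?thesis
      unfolding resolvent_identity[of z w] norm_scaleC K_def by (simp only: mult_ac)
  qed
  have ev: "\<forall>\<^sub>F z in at w. norm (R z - R w) \<le> cmod (z - w) * K * (2 * norm (R w))"
  proof -
    have "((\<lambda>z. cmod (z - w) * K) \<longlongrightarrow> cmod (w - w) * K) (at w)"
      by (intro tendsto_intros)
    then have "\<forall>\<^sub>F z in at w. cmod (z - w) * K < 1 / 2"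
      by (rule order_tendstoD) simp
    then show ?thesis
    proof eventually_elim
      case (elim z)
      have "norm (R z) \<le> norm (R w) + norm (R z - R w)"
        by (metis add.commute diff_add_cancel norm_triangle_ineq)
      also have "\<dots> \<le> norm (R w) + 1 / 2 * norm (R z)"
        using le[of z] elim by (smt (verit) mult_right_mono norm_ge_zero)
      finally have "norm (R z) \<le> 2 * norm (R w)" by simp
      then show ?case
        using le[of z] K by (smt (verit) mult_left_mono mult_nonneg_nonneg norm_ge_zero)
    qed
  qed
  have "((\<lambda>z. cmod (z - w) * K * (2 * norm (R w))) \<longlongrightarrow> cmod (w - w) * K * (2 * norm (R w))) (at w)"
    by (intro tendsto_intros)
  then have "((\<lambda>z. R z - R w) \<longlongrightarrow> 0) (at w)"
    by (intro Lim_null_comparison[OF ev]) simp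
  then show ?thesis
    by (simp add: isCont_def LIM_zero_cancel)
qed

lemma has_vector_derivative_resolvent:
  assumes "(f has_vector_derivative f') (at t)"
  shows "((\<lambda>t. R (f t)) has_vector_derivative f' *\<^sub>C (R (f t) * x * R (f t))) (at t)"
proof -
  have "isCont f t"
    using assms has_vector_derivative_continuous by blast
  then have "isCont (\<lambda>s. R (f s)) t"
    by (rule isCont_o2) (rule isCont_resolvent)
  moreover have "((\<lambda>s. (f s - f t) /\<^sub>R (s - t)) \<longlongrightarrow> f') (at t)"
    using assms by (simp add: has_vector_derivative_iff_slope)
  ultimately have "((\<lambda>s. ((f s - f t) /\<^sub>R (s - t)) *\<^sub>C (R (f s) * x * R (f t)))
      \<longlongrightarrow> f' *\<^sub>C (R (f t) * x * R (f t))) (at t)"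
    by (intro scaleC.tendsto tendsto_intros) (simp_all add: isCont_def)
  then show ?thesis
    by (simp add: has_vector_derivative_iff_slope scaleC.scaleR_left
        flip: resolvent_identity[of "f s" "f t" for s])
qed

lemma norm_resolvent_le:
  assumes y: "y * x = 1" and z: "norm y < cmod z"
  shows "norm (R z) \<le> norm y / (cmod z - norm y)"
proof -
  have "y * (z *\<^sub>C x * R z) = y * (R z - (1 - z *\<^sub>C x) * R z)"
    by (simp add: algebra_simps)
  then have "z *\<^sub>C R z = y * (R z - 1)"
    using y by (simp add: R_right scaleC_mult_left scaleC_mult_right flip: mult.assoc)
  then have "cmod z * norm (R z) \<le> norm y * norm (R z - 1)"
    by (metis norm_mult_ineq norm_scaleC)
  also have "\<dots> \<le> norm y * (norm (R z) + 1)"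
    by (intro mult_left_mono) (use norm_triangle_ineq4[of "R z" 1] in auto)
  finally show ?thesis
    using z by (simp add: field_simps)
qed

text \<open>
  The circular means of the resolvent do not depend on the radius \<open>e\<^sup>s\<close>, because the radial and the
  angular derivative differ by the factor \<open>\<i>\<close> and the latter integrates to zero.
\<close>

lemma not_is_invertible_of_entire_resolvent: "\<not> is_invertible x"
proof
  assume "is_invertible x"
  then obtain y where y: "y * x = 1" by (auto simp: is_invertible_def)
  define E :: "real \<Rightarrow> real \<Rightarrow> complex" where "E = (\<lambda>s t. exp (Complex s t))"
  define D where "D = (\<lambda>w. w *\<^sub>C (R w * x * R w))"
  define \<psi> where "\<psi> = (\<lambda>s. integral {0..2 * pi} (\<lambda>t. R (E s t)))"
  have E_eq: "E s t = exp (complex_of_real s + \<i> * complex_of_real t)" for s t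
    by (simp add: E_def Complex_eq)
  have norm_E: "cmod (E s t) = exp s" for s t
    by (simp add: E_def)
  have contR: "continuous_on UNIV R"
    by (simp add: continuous_at_imp_continuous_on isCont_resolvent)
  have contE: "continuous_on UNIV (\<lambda>(s, t). E s t)"
    unfolding E_eq case_prod_beta by (intro continuous_intros)
  have contRE: "continuous_on S (\<lambda>t. R (E s t))" for S s
    unfolding E_eq by (intro continuous_on_compose2[OF contR] continuous_intros) auto
  have contD: "continuous_on UNIV D"
    unfolding D_def by (intro scaleC.continuous_on continuous_intros contR)
  have ds: "((\<lambda>s. R (E s t)) has_vector_derivative D (E s t)) (at s)" for s t
  proof -
    have "((\<lambda>s. E s t) has_vector_derivative E s t) (at s)"
      unfolding E_eq
      by (rule has_vector_derivative_real_field[of "\<lambda>z. exp (z + \<i> * complex_of_real t)"])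
        (auto intro!: derivative_eq_intros)
    then show ?thesis
      unfolding D_def by (rule has_vector_derivative_resolvent)
  qed
  have dt: "((\<lambda>t. R (E s t)) has_vector_derivative \<i> *\<^sub>C D (E s t)) (at t)" for s t
  proof -
    have "((\<lambda>t. E s t) has_vector_derivative \<i> * E s t) (at t)"
      unfolding E_eq
      by (rule has_vector_derivative_real_field[of "\<lambda>z. exp (complex_of_real s + \<i> * z)"])
        (auto intro!: derivative_eq_intros)
    then show ?thesis
      unfolding D_def scaleC_scaleC by (rule has_vector_derivative_resolvent)
  qed
  have int_D: "integral {0..2 * pi} (\<lambda>t. D (E s t)) = 0" for s
  proof -
    have "((\<lambda>t. \<i> *\<^sub>C D (E s t)) has_integral R (E s (2 * pi)) - R (E s 0)) {0..2 * pi}"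
      by (rule fundamental_theorem_of_calculus)
        (auto intro: has_vector_derivative_at_within dt)
    moreover have "E s (2 * pi) = E s 0"
      using exp_two_pi_i by (simp add: E_eq exp_add mult_ac)
    ultimately have "((\<lambda>t. \<i> *\<^sub>C D (E s t)) has_integral 0) {0..2 * pi}"
      by simp
    from has_integral_linear[OF this scaleC.bounded_linear_right[of "- \<i>"]]
    have "((\<lambda>t. D (E s t)) has_integral 0) {0..2 * pi}"
      by (simp add: o_def scaleC_scaleC scaleC.zero_right)
    then show ?thesis by (rule integral_unique)
  qed
  have "(\<psi> has_vector_derivative 0) (at s)" for s
  proof -
    have "((\<lambda>s. integral (cbox 0 (2 * pi)) (\<lambda>t. R (E s t))) has_vector_derivative
        integral (cbox 0 (2 * pi)) (\<lambda>t. D (E s t))) (at s within UNIV)"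
    proof (rule leibniz_rule_vector_derivative)
      show "(\<lambda>t. R (E s t)) integrable_on cbox 0 (2 * pi)" for s
        by (intro integrable_continuous contRE)
      show "continuous_on (UNIV \<times> cbox 0 (2 * pi)) (\<lambda>(s, t). D (E s t))"
        unfolding case_prod_beta
        by (rule continuous_on_compose2[OF contD])
          (use continuous_on_subset[OF contE] in \<open>auto simp: case_prod_beta\<close>)
    qed (use ds in auto)
    then show ?thesis
      by (simp add: \<psi>_def int_D)
  qed
  then obtain c where c: "\<And>s. \<psi> s = c"
    using has_vector_derivative_zero_constant[of UNIV \<psi>] by auto
  have "norm (\<psi> s) \<le> 1 / 4 * (2 * pi)" if "s = ln (5 * norm y)" for s
  proof -
    have "y \<noteq> 0" using y by auto
    then have "norm (R (E s t)) \<le> 1 / 4" for t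
      using norm_resolvent_le[OF y, of "E s t"] that by (simp add: norm_E)
    then show ?thesis
      using integral_bound[of 0 "2 * pi" "\<lambda>t. R (E s t)" "1 / 4"] contRE by (simp add: \<psi>_def)
  qed
  then have c_le: "norm c \<le> 1 / 4 * (2 * pi)"
    using c by auto
  have R0: "R 0 = 1"
    using R_right[of 0] by simp
  obtain d where d: "d > 0" "\<And>z. cmod z < d \<Longrightarrow> norm (R z - 1) < 1 / 4"
  proof -
    obtain d where "d > 0" "\<forall>z. dist z 0 < d \<longrightarrow> dist (R z) (R 0) < 1 / 4"
      using isCont_resolvent[of 0] unfolding continuous_at_eps_delta
      by (metis zero_less_divide_1_iff zero_less_numeral)
    then show ?thesis
      using that[of d] by (simp add: R0 dist_norm)
  qed
  have "norm (\<psi> s - (2 * pi) *\<^sub>R 1) \<le> 1 / 4 * (2 * pi)" if "s = ln (d / 2)" for s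
  proof -
    have "norm (R (E s t) - 1) \<le> 1 / 4" for t
      using d that by (intro less_imp_le d(2)) (simp add: norm_E)
    moreover have "\<psi> s - (2 * pi) *\<^sub>R 1 = integral {0..2 * pi} (\<lambda>t. R (E s t) - 1)"
      unfolding \<psi>_def by (subst integral_diff) (auto intro!: integrable_continuous_real contRE)
    ultimately show ?thesis
      using integral_bound[of 0 "2 * pi" "\<lambda>t. R (E s t) - 1" "1 / 4"] contRE
      by (simp add: continuous_on_diff)
  qed
  then have "norm (c - (2 * pi) *\<^sub>R 1) \<le> 1 / 4 * (2 * pi)"
    using c by auto
  moreover have "norm ((2 * pi) *\<^sub>R (1 :: 'a)) \<le> norm c + norm (c - (2 * pi) *\<^sub>R 1)"
    by (metis norm_minus_commute norm_triangle_sub)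
  ultimately show False
    using c_le pi_gt_zero by simp
qed

end

lemma cstar_spectrum_nonempty: "cstar_spectrum (x :: 'a::cstar_algebra) \<noteq> {}"
proof
  assume empty: "cstar_spectrum x = {}"
  then have inv: "is_invertible (x - \<mu> *\<^sub>C 1)" for \<mu>
    by (metis empty_iff mem_cstar_spectrum_iff)
  have "is_invertible (1 - z *\<^sub>C x)" for z
  proof (cases "z = 0")
    case True
    then show ?thesis by (auto simp: is_invertible_def)
  next
    case False
    then have "1 - z *\<^sub>C x = (- z) *\<^sub>C (x - (1 / z) *\<^sub>C 1)"
      by (simp add: scaleC.diff_right scaleC_scaleC scaleC_minus_left)
    then show ?thesis
      using inv[of "1 / z"] False by (simp add: is_invertible_scaleC_iff)
  qed
  then obtain R where "\<And>z. R z * (1 - z *\<^sub>C x) = 1" "\<And>z. (1 - z *\<^sub>C x) * R z = 1"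
    unfolding is_invertible_def by metis
  moreover have "is_invertible x"
    using inv[of 0] by simp
  ultimately show False
    using not_is_invertible_of_entire_resolvent by blast
qed

section \<open>Gaussian binomial coefficients at irrational angles\<close>

fun qbinom :: "'a::comm_semiring_1 \<Rightarrow> nat \<Rightarrow> nat \<Rightarrow> 'a" where
  "qbinom q n 0 = 1"
| "qbinom q 0 (Suc j) = 0"
| "qbinom q (Suc n) (Suc j) = q ^ Suc j * qbinom q n (Suc j) + qbinom q n j"

lemma qbinom_eq_0: "n < j \<Longrightarrow> qbinom q n j = 0"
  by (induction q n j rule: qbinom.induct) auto

lemma prod_one_plus_eq_sum_qbinom:
  fixes q z :: "'a::comm_semiring_1"
  shows "(\<Prod>k<n. 1 + q ^ k * z) = (\<Sum>j\<le>n. q ^ (j choose 2) * qbinom q n j * z ^ j)"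
proof (induction n arbitrary: z)
  case (Suc n)
  define h where "h = (\<lambda>j. q ^ (j choose 2) * qbinom q n j * (q * z) ^ j)"
  have f_Suc: "q ^ (Suc j choose 2) * qbinom q (Suc n) (Suc j) * z ^ Suc j = h (Suc j) + z * h j" for j
    by (simp add: h_def numeral_2_eq_2 power_add power_mult_distrib algebra_simps)
  have "(\<Prod>k<Suc n. 1 + q ^ k * z) = (1 + z) * (\<Prod>k<n. 1 + q ^ k * (q * z))"
    by (subst prod.lessThan_Suc_shift) (simp add: mult_ac)
  also have "\<dots> = (1 + z) * sum h {..n}"
    by (simp add: Suc.IH h_def)
  also have "\<dots> = sum h {..Suc n} + z * sum h {..n}"
    by (simp add: h_def[THEN fun_cong, of "Suc n"] qbinom_eq_0 algebra_simps)
  also have "\<dots> = 1 + (\<Sum>j\<le>n. h (Suc j) + z * h j)"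
    by (subst sum.atMost_Suc_shift)
      (simp add: h_def sum.distrib sum_distrib_left add.assoc numeral_2_eq_2)
  also have "\<dots> = (\<Sum>j\<le>Suc n. q ^ (j choose 2) * qbinom q (Suc n) j * z ^ j)"
    by (subst sum.atMost_Suc_shift) (simp only: f_Suc, simp add: numeral_2_eq_2)
  finally show ?case .
qed (simp add: numeral_2_eq_2)

lemma power_add_q_commute:
  fixes x y :: "'a::cstar_algebra"
  assumes "y * x = q *\<^sub>C (x * y)"
  shows "(x + y) ^ n = (\<Sum>j\<le>n. qbinom q n j *\<^sub>C (x ^ (n - j) * y ^ j))"
proof (induction n)
  case (Suc n)
  define h where "h = (\<lambda>j. (q ^ j * qbinom q n j) *\<^sub>C (x ^ (Suc n - j) * y ^ j))"
  define k where "k = (\<lambda>j. qbinom q n j *\<^sub>C (x ^ (n - j) * y ^ Suc j))"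
  have yx: "y ^ j * x = q ^ j *\<^sub>C (x * y ^ j)" for j
  proof (induction j)
    case (Suc j)
    have "y ^ Suc j * x = y ^ j * (y * x)"
      by (simp only: power_Suc2 mult.assoc)
    also have "\<dots> = q *\<^sub>C ((y ^ j * x) * y)"
      by (simp add: assms scaleC_mult_right mult.assoc)
    also have "\<dots> = q ^ Suc j *\<^sub>C (x * y ^ Suc j)"
      by (simp add: Suc scaleC_mult_left scaleC_scaleC mult.assoc power_commutes)
    finally show ?case .
  qed simp
  have f_Suc: "qbinom q (Suc n) (Suc j) *\<^sub>C (x ^ (Suc n - Suc j) * y ^ Suc j) = h (Suc j) + k j" for j
    by (simp add: h_def k_def scaleC_add_left)
  have "(x + y) ^ Suc n = (\<Sum>j\<le>n. qbinom q n j *\<^sub>C (x ^ (n - j) * y ^ j)) * (x + y)"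
    by (simp only: power_Suc2 Suc.IH)
  also have "\<dots> = (\<Sum>j\<le>n. h j + k j)"
    unfolding sum_distrib_right
  proof (rule sum.cong)
    fix j assume "j \<in> {..n}"
    have "x ^ (n - j) * y ^ j * x = q ^ j *\<^sub>C (x ^ (n - j) * (x * y ^ j))"
      by (simp add: mult.assoc yx scaleC_mult_right)
    also have "x ^ (n - j) * (x * y ^ j) = x ^ (Suc n - j) * y ^ j"
      using \<open>j \<in> {..n}\<close> by (simp add: Suc_diff_le power_commutes flip: mult.assoc)
    finally have "qbinom q n j *\<^sub>C (x ^ (n - j) * y ^ j) * x = h j"
      by (simp add: h_def scaleC_mult_left scaleC_scaleC mult.commute)
    moreover have "qbinom q n j *\<^sub>C (x ^ (n - j) * y ^ j) * y = k j"
      by (simp add: k_def scaleC_mult_left mult.assoc power_commutes)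
    ultimately show "qbinom q n j *\<^sub>C (x ^ (n - j) * y ^ j) * (x + y) = h j + k j"
      by (simp add: distrib_left)
  qed simp
  also have "\<dots> = sum h {..Suc n} + sum k {..n}"
    by (simp add: sum.distrib h_def[THEN fun_cong, of "Suc n"] qbinom_eq_0)
  also have "\<dots> = h 0 + (\<Sum>j\<le>n. h (Suc j) + k j)"
    by (subst sum.atMost_Suc_shift) (simp add: sum.distrib add.assoc)
  also have "\<dots> = (\<Sum>j\<le>Suc n. qbinom q (Suc n) j *\<^sub>C (x ^ (Suc n - j) * y ^ j))"
    by (subst sum.atMost_Suc_shift) (simp only: f_Suc, simp add: h_def)
  finally show ?case .
qed simp

text \<open>
  In the power series of \<open>ln (1 + z)\<close>, averaged over the orbit \<open>q\<^sup>k z\<close>, each of the low order terms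
  contributes a bounded geometric sum, and the remaining terms are uniformly small.
\<close>

lemma norm_prod_one_plus_le:
  fixes q :: complex
  assumes q: "norm q = 1" "\<And>j. j > 0 \<Longrightarrow> q ^ j \<noteq> 1" and \<rho>: "0 \<le> \<rho>" "\<rho> < 1" and e: "e > 0"
  shows "\<exists>K. \<forall>n z. norm z \<le> \<rho> \<longrightarrow> norm (\<Prod>k<n. 1 + q ^ k * z) \<le> exp (K + real n * e)"
proof -
  define d :: "nat \<Rightarrow> complex" where "d = (\<lambda>j. (-1) ^ Suc j / of_nat j)"
  have norm_d: "norm (d j) \<le> 1" for j
    by (cases "j = 0") (simp_all add: d_def norm_divide norm_power)
  have "(\<lambda>N. \<rho> ^ N / (1 - \<rho>)) \<longlonglongrightarrow> 0 / (1 - \<rho>)"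
    using \<rho> by (intro tendsto_intros) auto
  then have "\<forall>\<^sub>F N in sequentially. \<rho> ^ N / (1 - \<rho>) < e"
    by (rule order_tendstoD) (simp add: e)
  then obtain N where N: "\<rho> ^ N / (1 - \<rho>) < e"
    by (auto simp: eventually_sequentially)
  define H where "H = (\<lambda>z. \<Sum>j<N. d j * z ^ j)"
  define K where "K = (\<Sum>j<N. 2 / norm (1 - q ^ j))"
  have tail: "norm (Ln (1 + z) - H z) \<le> e" if z: "norm z \<le> \<rho>" for z
  proof -
    have "(\<lambda>j. d j * z ^ j) sums Ln (1 + z)"
      unfolding d_def using Ln_series[of z] z \<rho> by simp
    then have *: "(\<lambda>j. d (j + N) * z ^ (j + N)) sums (Ln (1 + z) - H z)"
      unfolding H_def by (rule sums_split_initial_segment)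
    have **: "(\<lambda>j. \<rho> ^ N * \<rho> ^ j) sums (\<rho> ^ N * (1 / (1 - \<rho>)))"
      using \<rho> by (intro sums_mult geometric_sums) simp
    have "norm (d (j + N) * z ^ (j + N)) \<le> \<rho> ^ N * \<rho> ^ j" for j
    proof -
      have "norm (d (j + N)) * norm z ^ (j + N) \<le> 1 * \<rho> ^ (j + N)"
        by (intro mult_mono power_mono norm_d z) auto
      then show ?thesis
        by (simp add: norm_mult norm_power power_add mult.commute)
    qed
    then have "norm (Ln (1 + z) - H z) \<le> \<rho> ^ N * (1 / (1 - \<rho>))"
      using norm_suminf_le[of "\<lambda>j. d (j + N) * z ^ (j + N)" "\<lambda>j. \<rho> ^ N * \<rho> ^ j"] * **
      by (simp add: sums_iff)
    then show ?thesis using N by simp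
  qed
  have head: "norm (\<Sum>k<n. H (q ^ k * z)) \<le> K" if z: "norm z \<le> \<rho>" for z n
  proof -
    have "(\<Sum>k<n. H (q ^ k * z)) = (\<Sum>j<N. d j * z ^ j * (\<Sum>k<n. (q ^ j) ^ k))"
      unfolding H_def sum_distrib_left
      by (subst sum.swap) (simp add: power_mult_distrib mult_ac flip: power_mult)
    also have "norm \<dots> \<le> K"
      unfolding K_def
    proof (rule sum_norm_le)
      fix j
      show "norm (d j * z ^ j * (\<Sum>k<n. (q ^ j) ^ k)) \<le> 2 / norm (1 - q ^ j)"
      proof (cases "j = 0")
        case False
        have "norm (\<Sum>k<n. (q ^ j) ^ k) = norm (1 - (q ^ j) ^ n) / norm (1 - q ^ j)"
          using q(2)[of j] False by (simp add: sum_gp_strict norm_divide)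
        also have "\<dots> \<le> 2 / norm (1 - q ^ j)"
          using norm_triangle_ineq4[of 1 "(q ^ j) ^ n"] q(1)
          by (intro divide_right_mono) (simp_all add: norm_power)
        finally have le: "norm (\<Sum>k<n. (q ^ j) ^ k) \<le> 2 / norm (1 - q ^ j)" .
        have "norm (d j) * norm z ^ j \<le> 1 * 1 ^ j"
          using z \<rho> by (intro mult_mono power_mono norm_d) auto
        with le have "norm (d j) * norm z ^ j * norm (\<Sum>k<n. (q ^ j) ^ k) \<le> 1 * (2 / norm (1 - q ^ j))"
          by (intro mult_mono) auto
        then show ?thesis by (simp add: norm_mult norm_power)
      qed (simp add: d_def)
    qed
    finally show ?thesis .
  qed
  have "norm (\<Prod>k<n. 1 + q ^ k * z) \<le> exp (K + real n * e)" if z: "norm z \<le> \<rho>" for n z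
  proof -
    have le: "norm (q ^ k * z) \<le> \<rho>" for k
      using z q(1) by (simp add: norm_mult norm_power)
    have "1 + q ^ k * z \<noteq> 0" for k
    proof
      assume "1 + q ^ k * z = 0"
      then have "norm (q ^ k * z) = 1"
        by (metis add_eq_0_iff norm_minus_cancel norm_one)
      then show False using le[of k] \<rho> by simp
    qed
    then have "(\<Prod>k<n. 1 + q ^ k * z) = exp (\<Sum>k<n. Ln (1 + q ^ k * z))"
      by (simp add: exp_sum)
    then have "norm (\<Prod>k<n. 1 + q ^ k * z) = exp (Re (\<Sum>k<n. Ln (1 + q ^ k * z)))"
      by simp
    also have "Re (\<Sum>k<n. Ln (1 + q ^ k * z)) \<le> norm (\<Sum>k<n. Ln (1 + q ^ k * z))"
      by (rule complex_Re_le_cmod)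
    also have "(\<Sum>k<n. Ln (1 + q ^ k * z))
        = (\<Sum>k<n. H (q ^ k * z)) + (\<Sum>k<n. Ln (1 + q ^ k * z) - H (q ^ k * z))"
      by (simp add: sum_subtractf)
    also have "norm \<dots> \<le> K + (\<Sum>k<n. e)"
      by (intro norm_triangle_le add_mono head z sum_norm_le tail le)
    finally show ?thesis by simp
  qed
  then show ?thesis by blast
qed

lemma norm_coeff_le:
  fixes c :: "nat \<Rightarrow> complex"
  assumes \<rho>: "0 \<le> \<rho>" and le: "\<And>z. norm z = \<rho> \<Longrightarrow> norm (\<Sum>i\<le>n. c i * z ^ i) \<le> M" and j: "j \<le> n"
  shows "norm (c j) * \<rho> ^ j \<le> M"
proof -
  define \<omega> where "\<omega> = cis (2 * pi / real (Suc n))"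
  have \<omega>: "\<omega> ^ Suc n = 1" "norm \<omega> = 1" "\<omega> \<noteq> 0"
    unfolding \<omega>_def Complex.DeMoivre by simp_all
  have orth: "(\<Sum>m<Suc n. (\<omega> ^ i / \<omega> ^ j) ^ m) = (if i = j then of_nat (Suc n) else 0)" if i: "i \<le> n" for i
  proof (cases "i = j")
    case False
    have "\<omega> ^ k = cis (2 * pi * real k / real (Suc n))" for k
      unfolding \<omega>_def Complex.DeMoivre by (simp add: mult_ac)
    moreover have "inj_on (\<lambda>k. cis (2 * pi * real k / real (Suc n))) {..<Suc n}"
      using Complex.bij_betw_roots_unity[of "Suc n"] by (simp add: bij_betw_def del: of_nat_Suc)
    ultimately have "\<omega> ^ i \<noteq> \<omega> ^ j"
      unfolding inj_on_def by (metis False i j le_imp_less_Suc lessThan_iff)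
    moreover have "(\<omega> ^ i / \<omega> ^ j) ^ Suc n = 1"
      using \<omega>(1) by (metis (no_types) divide_self_if mult.commute power_divide power_mult power_one zero_neq_one)
    ultimately show ?thesis
      using False \<omega>(3) by (subst sum_gp_strict) auto
  qed (use \<omega> in simp)
  have "(\<Sum>m<Suc n. (\<Sum>i\<le>n. c i * (\<rho> * \<omega> ^ m) ^ i) / (\<omega> ^ j) ^ m)
      = (\<Sum>i\<le>n. c i * \<rho> ^ i * (\<Sum>m<Suc n. (\<omega> ^ i / \<omega> ^ j) ^ m))"
    unfolding sum_divide_distrib sum_distrib_left
    by (subst sum.swap) (simp add: power_mult_distrib power_divide mult_ac flip: power_mult)
  also have "\<dots> = (\<Sum>i\<le>n. if i = j then c j * \<rho> ^ j * of_nat (Suc n) else 0)"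
    by (intro sum.cong) (auto simp: orth simp del: sum.lessThan_Suc)
  also have "\<dots> = c j * \<rho> ^ j * of_nat (Suc n)"
    using j by simp
  finally have eq: "c j * \<rho> ^ j * of_nat (Suc n)
      = (\<Sum>m<Suc n. (\<Sum>i\<le>n. c i * (\<rho> * \<omega> ^ m) ^ i) / (\<omega> ^ j) ^ m)" ..
  have "norm (c j) * \<rho> ^ j * real (Suc n) = norm (c j * \<rho> ^ j * of_nat (Suc n))"
    using \<rho> by (simp add: norm_mult norm_power del: of_nat_Suc)
  also have "\<dots> \<le> (\<Sum>m<Suc n. M)"
    unfolding eq
  proof (rule sum_norm_le)
    fix m
    show "norm ((\<Sum>i\<le>n. c i * (\<rho> * \<omega> ^ m) ^ i) / (\<omega> ^ j) ^ m) \<le> M"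
      using le[of "\<rho> * \<omega> ^ m"] \<omega>(2) \<rho> by (simp add: norm_divide norm_power norm_mult)
  qed
  finally have "norm (c j) * \<rho> ^ j * real (Suc n) \<le> M * real (Suc n)"
    by (simp add: mult.commute)
  then show ?thesis
    using mult_right_le_imp_le of_nat_0_less_iff zero_less_Suc by blast
qed

lemma norm_qbinom_le:
  fixes q :: complex
  assumes q: "norm q = 1" "\<And>j. j > 0 \<Longrightarrow> q ^ j \<noteq> 1" and \<eta>: "\<eta> > 1"
  shows "\<exists>C\<ge>0. \<forall>n j. norm (qbinom q n j) \<le> C * \<eta> ^ n"
proof -
  define e where "e = ln \<eta> / 2"
  have e: "e > 0" using \<eta> by (simp add: e_def)
  have \<eta>_eq: "exp e * exp e = \<eta>"
    using \<eta> by (simp add: e_def flip: exp_add)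
  obtain K where K: "\<And>n z. norm z \<le> exp (- e) \<Longrightarrow> norm (\<Prod>k<n. 1 + q ^ k * z) \<le> exp (K + real n * e)"
    using norm_prod_one_plus_le[OF q, of "exp (- e)" e] e by auto
  have "norm (qbinom q n j) \<le> exp K * \<eta> ^ n" for n j
  proof (cases "j \<le> n")
    case True
    have "norm (q ^ (j choose 2) * qbinom q n j) * exp (- e) ^ j \<le> exp (K + real n * e)"
      by (rule norm_coeff_le[OF _ _ True]) (use K in \<open>auto simp flip: prod_one_plus_eq_sum_qbinom\<close>)
    then have "norm (qbinom q n j) * exp (- e) ^ j \<le> exp (K + real n * e)"
      using q(1) by (simp add: norm_mult norm_power)
    then have "norm (qbinom q n j) * exp (- e) ^ j * exp e ^ j \<le> exp (K + real n * e) * exp e ^ j"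
      by (rule mult_right_mono) simp
    then have "norm (qbinom q n j) \<le> exp (K + real n * e) * exp e ^ j"
      by (simp add: mult.assoc exp_minus flip: power_mult_distrib)
    also have "\<dots> \<le> exp (K + real n * e) * exp e ^ n"
      using e True by (intro mult_left_mono power_increasing) auto
    also have "\<dots> = exp K * \<eta> ^ n"
      by (simp add: exp_add exp_of_nat_mult power_mult_distrib flip: \<eta>_eq)
    finally show ?thesis .
  qed (use \<eta> in \<open>simp add: qbinom_eq_0\<close>)
  then show ?thesis
    by (intro exI[of _ "exp K"]) auto
qed

lemma is_invertible_one_minus_q_commute:
  fixes x y :: "'a::cstar_algebra"
  assumes q: "norm q = 1" "\<And>j. j > 0 \<Longrightarrow> q ^ j \<noteq> 1" and yx: "y * x = q *\<^sub>C (x * y)"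
    and le: "norm x \<le> s" "norm y \<le> s" and s: "s < 1"
  shows "is_invertible (1 - (x + y))"
proof (rule is_invertible_one_minus)
  have s0: "0 \<le> s" using le(1) norm_ge_zero order_trans by blast
  define \<eta> where "\<eta> = 2 / (1 + s)"
  have \<eta>: "\<eta> > 1" "s * \<eta> < 1" using s s0 by (simp_all add: \<eta>_def field_simps)
  obtain C where C: "C \<ge> 0" "\<And>n j. norm (qbinom q n j) \<le> C * \<eta> ^ n"
    using norm_qbinom_le[OF q \<eta>(1)] by blast
  have bound: "norm ((x + y) ^ n) \<le> C * (of_nat (Suc n) * (s * \<eta>) ^ n)" for n
  proof -
    have "norm ((x + y) ^ n) \<le> (\<Sum>j\<le>n. C * \<eta> ^ n * s ^ n)"
      unfolding power_add_q_commute[OF yx]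
    proof (rule sum_norm_le)
      fix j assume "j \<in> {..n}"
      have "norm (x ^ (n - j) * y ^ j) \<le> norm x ^ (n - j) * norm y ^ j"
        by (meson mult_mono norm_ge_zero norm_mult_ineq norm_power_ineq order_trans zero_le_power)
      also have "\<dots> \<le> s ^ (n - j) * s ^ j"
        using le s0 by (intro mult_mono power_mono) auto
      also have "\<dots> = s ^ n"
        using \<open>j \<in> {..n}\<close> by (simp flip: power_add)
      finally show "norm (qbinom q n j *\<^sub>C (x ^ (n - j) * y ^ j)) \<le> C * \<eta> ^ n * s ^ n"
        unfolding norm_scaleC using C \<eta>(1) by (intro mult_mono) auto
    qed
    then show ?thesis by (simp add: power_mult_distrib mult_ac)
  qed
  have "norm (s * \<eta>) < 1"
    using \<eta> s0 by simp
  then have "summable (\<lambda>n. C * (of_nat (Suc n) * (s * \<eta>) ^ n))"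
    by (rule summable_mult[OF sums_summable[OF geometric_deriv_sums]])
  then show "summable (\<lambda>n. norm ((x + y) ^ n))"
    by (rule summable_comparison_test') (use bound in auto)
qed

section \<open>Rotation pairs\<close>

lemma is_invertible_unitary: "is_unitary x \<Longrightarrow> is_invertible x"
  by (auto simp: is_unitary_def is_invertible_def)

lemma norm_unitary: "is_unitary x \<Longrightarrow> norm x = 1"
  using cstar_identity[of x] norm_ge_zero[of x] by (auto simp: is_unitary_def power2_eq_1_iff)

lemma is_unitary_adj: "is_unitary x \<Longrightarrow> is_unitary (adj x)"
  by (simp add: is_unitary_def adj_adj)

lemma is_unitary_mult:
  assumes "is_unitary x" "is_unitary y"
  shows "is_unitary (x * y)"
proof -
  have "adj (x * y) * (x * y) = adj y * (adj x * x) * y" "x * y * adj (x * y) = x * (y * adj y) * adj x"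
    by (simp_all only: adj_mult mult.assoc)
  then show ?thesis
    using assms by (simp add: is_unitary_def)
qed

definition rotation_pair :: "real \<Rightarrow> 'a::cstar_algebra \<Rightarrow> 'a \<Rightarrow> bool" where
  "rotation_pair \<theta> u v \<longleftrightarrow>
     is_unitary u \<and> is_unitary v \<and> v * u = cis (2 * pi * \<theta>) *\<^sub>C (u * v)"

lemma rotation_pair_swap: "rotation_pair \<theta> u v \<Longrightarrow> rotation_pair (- \<theta>) v u"
  by (simp add: rotation_pair_def scaleC_scaleC cis_mult)

lemma rotation_pair_adj_left:
  assumes "rotation_pair \<theta> u v"
  shows "adj u * v = cis (2 * pi * \<theta>) *\<^sub>C (v * adj u)"
proof -
  have u: "adj u * u = 1" "u * adj u = 1" and vu: "v * u = cis (2 * pi * \<theta>) *\<^sub>C (u * v)"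
    using assms by (simp_all add: rotation_pair_def is_unitary_def)
  have "adj u * v = adj u * (v * u) * adj u"
    using u by (simp add: mult.assoc)
  also have "\<dots> = cis (2 * pi * \<theta>) *\<^sub>C ((adj u * u) * (v * adj u))"
    unfolding vu scaleC_mult_left scaleC_mult_right by (simp only: mult.assoc)
  finally show ?thesis using u by simp
qed

lemma rotation_pair_quotient:
  assumes "rotation_pair \<theta> u v"
  shows "rotation_pair \<theta> (adj u * v) (adj u)"
proof -
  have "adj u * (adj u * v) = adj u * (cis (2 * pi * \<theta>) *\<^sub>C (v * adj u))"
    by (simp only: rotation_pair_adj_left[OF assms])
  then have "adj u * (adj u * v) = cis (2 * pi * \<theta>) *\<^sub>C (adj u * v * adj u)"
    by (simp only: scaleC_mult_right mult.assoc)
  then show ?thesis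
    using assms by (simp add: rotation_pair_def is_unitary_adj is_unitary_mult)
qed

lemma cis_irrational_power_neq_1:
  assumes "\<theta> \<notin> \<rat>" "j > 0"
  shows "cis (2 * pi * \<theta>) ^ j \<noteq> 1"
proof
  assume "cis (2 * pi * \<theta>) ^ j = 1"
  then have "cos (real j * (2 * pi * \<theta>)) = 1"
    unfolding Complex.DeMoivre by (metis cis.simps(1) one_complex.simps(1))
  then obtain m :: int where "real j * (2 * pi * \<theta>) = of_int m * 2 * pi"
    using cos_one_2pi_int by blast
  then have "\<theta> = of_int m / of_nat j"
    using \<open>j > 0\<close> by (simp add: field_simps)
  then show False
    using assms(1) by simp
qed

lemma is_invertible_dominant:
  fixes u v :: "'a::cstar_algebra"
  assumes uv: "rotation_pair \<theta> u v" and \<theta>: "\<theta> \<notin> \<rat>" and dom: "cmod a < cmod c" "cmod b < cmod c"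
  shows "is_invertible (c *\<^sub>C 1 + a *\<^sub>C u + b *\<^sub>C v)"
proof -
  have c: "c \<noteq> 0" using dom by auto
  define x where "x = (- a / c) *\<^sub>C u"
  define y where "y = (- b / c) *\<^sub>C v"
  have norms: "norm x = cmod a / cmod c" "norm y = cmod b / cmod c"
    using uv by (simp_all add: x_def y_def norm_scaleC norm_divide norm_unitary rotation_pair_def)
  have "is_invertible (1 - (x + y))"
  proof (rule is_invertible_one_minus_q_commute)
    show "y * x = cis (2 * pi * \<theta>) *\<^sub>C (x * y)"
      using uv by (simp add: x_def y_def rotation_pair_def scaleC_mult_left scaleC_mult_right
          scaleC_scaleC mult_ac)
    show "norm x \<le> max (norm x) (norm y)" "norm y \<le> max (norm x) (norm y)" by simp_all
    show "max (norm x) (norm y) < 1"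
      using dom c by (simp add: norms)
  qed (use \<theta> in \<open>simp_all add: cis_irrational_power_neq_1\<close>)
  moreover have "c *\<^sub>C 1 + a *\<^sub>C u + b *\<^sub>C v = c *\<^sub>C (1 - (x + y))"
    using c by (simp add: x_def y_def scaleC.diff_right scaleC_add_right scaleC_scaleC
        scaleC_minus_left scaleC.minus_right)
  ultimately show ?thesis
    using c by (simp add: is_invertible_scaleC_iff)
qed

text \<open>Conjugation by \<open>u\<^sup>* v\<close> multiplies both \<open>u\<close> and \<open>v\<close> by \<open>e\<^sup>2\<^sup>\<pi>\<^sup>i\<^sup>\<theta>\<close>.\<close>

lemma cstar_spectrum_rotation_invariant:
  fixes u v :: "'a::cstar_algebra"
  assumes uv: "rotation_pair \<theta> u v" and \<mu>: "\<mu> \<in> cstar_spectrum (u + b *\<^sub>C v)"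
  shows "cis (2 * pi * \<theta>) * \<mu> \<in> cstar_spectrum (u + b *\<^sub>C v)"
proof -
  define q where "q = cis (2 * pi * \<theta>)"
  define w where "w = adj u * v"
  define x where "x = u + b *\<^sub>C v"
  have "is_unitary w"
    using uv by (simp add: w_def rotation_pair_def is_unitary_adj is_unitary_mult)
  then obtain w' where w': "w' * w = 1" "w * w' = 1"
    using is_invertible_unitary is_invertible_def by blast
  have "w * u = q *\<^sub>C (u * w)"
  proof -
    have "w * u = q *\<^sub>C (adj u * u * v)"
      using uv by (simp add: w_def q_def rotation_pair_def mult.assoc scaleC_mult_right)
    also have "adj u * u = u * adj u"
      using uv by (simp add: rotation_pair_def is_unitary_def)
    finally show ?thesis by (simp add: w_def mult.assoc)
  qed
  moreover have "w * v = q *\<^sub>C (v * w)"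
    using rotation_pair_adj_left[OF uv]
    by (simp add: w_def q_def scaleC_mult_left mult.assoc)
  ultimately have "w * x = q *\<^sub>C (x * w)"
    by (simp add: x_def distrib_left distrib_right scaleC_mult_left scaleC_mult_right scaleC_scaleC
        scaleC_add_right mult.commute)
  then have "w * (x - (q * \<mu>) *\<^sub>C 1) = q *\<^sub>C ((x - \<mu> *\<^sub>C 1) * w)"
    by (simp add: algebra_simps scaleC_mult_left scaleC_mult_right scaleC.diff_right scaleC_scaleC)
  then have "w * (x - (q * \<mu>) *\<^sub>C 1) * w' = q *\<^sub>C (x - \<mu> *\<^sub>C 1)"
    using w' by (simp add: scaleC_mult_left mult.assoc)
  moreover have "q \<noteq> 0" by (simp add: q_def)
  moreover have "is_invertible w" "is_invertible w'"
    using w' by (auto simp: is_invertible_def)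
  ultimately have "\<not> is_invertible (x - (q * \<mu>) *\<^sub>C 1)"
    using \<mu> is_invertible_mult is_invertible_scaleC_iff unfolding mem_cstar_spectrum_iff x_def
    by metis
  then show ?thesis
    by (simp add: mem_cstar_spectrum_iff x_def q_def)
qed

lemma sphere_subset_if_irrational_rotation_invariant:
  fixes S :: "complex set"
  assumes \<theta>: "\<theta> \<notin> \<rat>" and S: "closed S" "p \<in> S" "cmod p = 1"
    and inv: "\<And>z. z \<in> S \<Longrightarrow> cis (2 * pi * \<theta>) * z \<in> S"
  shows "sphere 0 1 \<subseteq> S"
proof -
  define g where "g = (\<lambda>t. cis (2 * pi * t) * p)"
  have power: "cis (2 * pi * \<theta>) ^ n * p \<in> S" for n
    by (induction n) (use S inv in \<open>simp_all add: mult.assoc\<close>)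
  have "g (frac (real n * \<theta>)) \<in> S" for n
  proof -
    have "2 * pi * frac (real n * \<theta>) = real n * (2 * pi * \<theta>) - 2 * pi * of_int \<lfloor>real n * \<theta>\<rfloor>"
      by (simp add: frac_def algebra_simps)
    then have "cis (2 * pi * frac (real n * \<theta>)) = cis (2 * pi * \<theta>) ^ n"
      unfolding Complex.DeMoivre by (simp flip: cis_divide)
    then show ?thesis using power by (simp add: g_def)
  qed
  then have "g ` closure (range (\<lambda>n. frac (real n * \<theta>))) \<subseteq> S"
    by (intro image_closure_subset) (auto simp: g_def S intro!: continuous_intros)
  then have g: "g ` {0..1} \<subseteq> S"
    by (simp only: Kronecker_approx_1[OF \<theta>])
  show ?thesis
  proof
    fix z :: complex assume "z \<in> sphere 0 1"
    then have "z / p = cis (Arg2pi (z / p))"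
      using Arg2pi_eq[of "z / p"] S(3) by (simp add: cis_conv_exp norm_divide)
    then have "z = g (Arg2pi (z / p) / (2 * pi))"
      using S(3) by (auto simp: g_def field_simps)
    moreover have "Arg2pi (z / p) / (2 * pi) \<in> {0..1}"
      using Arg2pi[of "z / p"] by (auto simp: field_simps)
    ultimately show "z \<in> S" using g by blast
  qed
qed

lemma cstar_spectrum_rotation_pair:
  fixes u v :: "'a::cstar_algebra"
  assumes uv: "rotation_pair \<theta> u v" and \<theta>: "\<theta> \<notin> \<rat>" and b: "cmod b < 1"
  shows "cstar_spectrum (u + b *\<^sub>C v) = sphere 0 1"
proof
  show sub: "cstar_spectrum (u + b *\<^sub>C v) \<subseteq> sphere 0 1"
  proof
    fix \<mu> assume \<mu>: "\<mu> \<in> cstar_spectrum (u + b *\<^sub>C v)"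
    have "\<not> cmod \<mu> > 1"
      using is_invertible_dominant[OF uv \<theta>, of 1 "- \<mu>" b] \<mu> b
      by (auto simp: mem_cstar_spectrum_iff scaleC_minus_left algebra_simps)
    moreover have "\<not> cmod \<mu> < 1"
    proof
      assume "cmod \<mu> < 1"
      then have "is_invertible (1 *\<^sub>C 1 + b *\<^sub>C (adj u * v) + (- \<mu>) *\<^sub>C adj u)"
        using b by (intro is_invertible_dominant[OF rotation_pair_quotient[OF uv] \<theta>]) auto
      then have "is_invertible (u * (1 *\<^sub>C 1 + b *\<^sub>C (adj u * v) + (- \<mu>) *\<^sub>C adj u))"
        using uv by (simp add: is_invertible_mult_left_iff is_invertible_unitary rotation_pair_def)
      also have "u * (1 *\<^sub>C 1 + b *\<^sub>C (adj u * v) + (- \<mu>) *\<^sub>C adj u) = u + b *\<^sub>C v - \<mu> *\<^sub>C 1"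
        using uv by (simp add: distrib_left right_diff_distrib scaleC_mult_right scaleC_minus_left rotation_pair_def
            is_unitary_def flip: mult.assoc)
      finally show False
        using \<mu> by (simp add: mem_cstar_spectrum_iff)
    qed
    ultimately show "\<mu> \<in> sphere 0 1" by simp
  qed
  obtain p where "p \<in> cstar_spectrum (u + b *\<^sub>C v)"
    using cstar_spectrum_nonempty by blast
  then show "sphere 0 1 \<subseteq> cstar_spectrum (u + b *\<^sub>C v)"
    using sub
    by (intro sphere_subset_if_irrational_rotation_invariant[OF \<theta> closed_cstar_spectrum, of p]
        cstar_spectrum_rotation_invariant[OF uv]) auto
qed

lemma cstar_spectrum_rotation_pair_sum:
  fixes u v :: "'a::cstar_algebra"
  assumes uv: "rotation_pair \<theta> u v" and \<theta>: "\<theta> \<notin> \<rat>"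
  shows "cstar_spectrum (u + v) = cball 0 1"
proof
  show "cstar_spectrum (u + v) \<subseteq> cball 0 1"
  proof
    fix \<mu> assume \<mu>: "\<mu> \<in> cstar_spectrum (u + v)"
    have "\<not> cmod \<mu> > 1"
      using is_invertible_dominant[OF uv \<theta>, of 1 "- \<mu>" 1] \<mu>
      by (auto simp: mem_cstar_spectrum_iff scaleC_minus_left algebra_simps)
    then show "\<mu> \<in> cball 0 1" by simp
  qed
  have "ball 0 1 \<subseteq> cstar_spectrum (u + v)"
  proof
    fix \<mu> :: complex assume "\<mu> \<in> ball 0 1"
    then have "- 1 \<in> cstar_spectrum (adj u * v + (- \<mu>) *\<^sub>C adj u)"
      using cstar_spectrum_rotation_pair[OF rotation_pair_quotient[OF uv] \<theta>, of "- \<mu>"] by simp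
    then have "\<not> is_invertible (adj u * v + (- \<mu>) *\<^sub>C adj u + 1)"
      by (simp add: mem_cstar_spectrum_iff scaleC_minus_left)
    then have "\<not> is_invertible (u * (adj u * v + (- \<mu>) *\<^sub>C adj u + 1))"
      using uv by (simp add: is_invertible_mult_left_iff is_invertible_unitary rotation_pair_def)
    also have "u * (adj u * v + (- \<mu>) *\<^sub>C adj u + 1) = u + v - \<mu> *\<^sub>C 1"
      using uv by (simp add: distrib_left right_diff_distrib scaleC_mult_right scaleC_minus_left rotation_pair_def
          is_unitary_def flip: mult.assoc)
    finally show "\<mu> \<in> cstar_spectrum (u + v)"
      by (simp add: mem_cstar_spectrum_iff)
  qed
  then have "closure (ball 0 1) \<subseteq> cstar_spectrum (u + v)"
    by (rule closure_minimal) (rule closed_cstar_spectrum)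
  then show "cball 0 1 \<subseteq> cstar_spectrum (u + v)"
    by simp
qed

lemma cstar_spectrum_scaleC:
  assumes "c \<noteq> 0"
  shows "\<mu> \<in> cstar_spectrum (c *\<^sub>C x) \<longleftrightarrow> \<mu> / c \<in> cstar_spectrum x"
proof -
  have "c *\<^sub>C x - \<mu> *\<^sub>C 1 = c *\<^sub>C (x - (\<mu> / c) *\<^sub>C 1)"
    using assms by (simp add: scaleC.diff_right scaleC_scaleC)
  then show ?thesis
    using assms by (simp add: mem_cstar_spectrum_iff is_invertible_scaleC_iff)
qed

theorem theorem11p1:
  fixes \<theta> r :: real and u v :: "'a::cstar_algebra"
  assumes "0 < \<theta>" "\<theta> < 1" "\<theta> \<notin> \<rat>"
    and "universal_rotation_algebra \<theta> u v"
    and "0 < r"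
  shows "cstar_spectrum (u + complex_of_real r *\<^sub>C v) =
    (if r < 1 then sphere 0 1 else if r = 1 then cball 0 1 else sphere 0 r)"
proof -
  have "exp (2 * complex_of_real pi * \<i> * complex_of_real \<theta>) = cis (2 * pi * \<theta>)"
    by (simp add: cis_conv_exp mult_ac)
  then have uv: "rotation_pair \<theta> u v"
    using assms(4) by (simp add: universal_rotation_algebra_def rotation_pair_def)
  consider "r < 1" | "r = 1" | "r > 1" by linarith
  then show ?thesis
  proof cases
    case 1
    then show ?thesis
      using cstar_spectrum_rotation_pair[OF uv assms(3), of r] \<open>0 < r\<close> by simp
  next
    case 2
    then show ?thesis
      using cstar_spectrum_rotation_pair_sum[OF uv assms(3)] by simp
  next
    case 3
    have "- \<theta> \<notin> \<rat>" using assms(3) by simp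
    then have spec: "cstar_spectrum (v + complex_of_real (1 / r) *\<^sub>C u) = sphere 0 1"
      using 3 by (intro cstar_spectrum_rotation_pair[OF rotation_pair_swap[OF uv]]) (auto simp: norm_divide)
    have "u + complex_of_real r *\<^sub>C v = complex_of_real r *\<^sub>C (v + complex_of_real (1 / r) *\<^sub>C u)"
      using 3 by (simp add: scaleC_add_right scaleC_scaleC add.commute)
    then have "\<mu> \<in> cstar_spectrum (u + complex_of_real r *\<^sub>C v) \<longleftrightarrow> \<mu> \<in> sphere 0 r" for \<mu>
      using 3 spec by (auto simp: cstar_spectrum_scaleC norm_divide)
    then have "cstar_spectrum (u + complex_of_real r *\<^sub>C v) = sphere 0 r"
      by blast
    then show ?thesis using 3 by simp
  qed
qed

end
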